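(* For every connected graph $H$ (with at least three nodes, of constant size) and every $r \geq r'_H$, where $r'_H = \operatorname{diam}(H) - 1$, the $r$-round bandwidth complexity of $\textsc{MemList}(H)$ under node deletions is $O((\log n)/r)$.
   Context: $\operatorname{diam}(H)$ is the ordinary diameter. Dynamic network model: a sequence of graphs $G^0, G^1, \ldots$ with $n$ nodes initially, each obtained from the previous by at most one node deletion (removing a node with its incident edges); nodes have distinct IDs from $[n]$, know their neighbors' IDs and initially the whole of $G^0$; communication is synchronous, each round the change happens first, then each node sends a $B$-bit message to each neighbor; nodes detect changes only via their neighbor lists; algorithms are deterministic. An $r$-round algorithm works under the promise that each change at round $i$ is followed by $r-1$ change-free rounds and must output correctly for $G^i$ by the end of round $i+r-1$. The $r$-round bandwidth complexity is the minimum such $B$. $\textsc{MemList}(H)$: each node $v$ lists all subgraphs isomorphic to $H$ containing $v$. *)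

theory Defs
  imports "Graph_Theory.Graph_Theory" "HOL-Library.Extended_Nat"
begin

text \<open>
  Finite simple graphs are rendered as \<^locale>\<open>pair_graph\<close>: a finite vertex set with a symmetric,
  loop-free arc relation.
\<close>

definition graph_dist :: "'a pair_pre_digraph \<Rightarrow> 'a \<Rightarrow> 'a \<Rightarrow> nat" where
  "graph_dist G u v = (LEAST k. \<exists>p. pre_digraph.awalk (with_proj G) u p v \<and> length p = k)"

text \<open>Only meaningful for finite connected graphs, which are nonempty by definition.\<close>

definition diam :: "'a pair_pre_digraph \<Rightarrow> nat" where
  "diam G = Max {graph_dist G u v | u v. u \<in> pverts G \<and> v \<in> pverts G}"

definition neighbors :: "'a pair_pre_digraph \<Rightarrow> 'a \<Rightarrow> 'a set" where
  "neighbors G v = {u. (v, u) \<in> parcs G}"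

text \<open>
  The nodes are identified with their IDs. The graph at the end of round \<open>i\<close> is \<open>Gs i\<close>; rounds are
  numbered from 1, so that the change of round \<open>i\<close> leads from \<open>Gs (i - 1)\<close> to \<open>Gs i\<close>.
\<close>

definition node_deletion_sequence :: "nat \<Rightarrow> (nat \<Rightarrow> nat pair_pre_digraph) \<Rightarrow> bool" where
  "node_deletion_sequence n Gs \<longleftrightarrow>
     pair_graph (Gs 0) \<and> pverts (Gs 0) = {1..n} \<and>
     (\<forall>i. Gs (Suc i) = Gs i \<or>
       (\<exists>v \<in> pverts (Gs i).
          with_proj (Gs (Suc i)) = pre_digraph.del_vert (with_proj (Gs i)) v))"

definition change_at :: "(nat \<Rightarrow> nat pair_pre_digraph) \<Rightarrow> nat \<Rightarrow> bool" where
  "change_at Gs i \<longleftrightarrow> 1 \<le> i \<and> Gs i \<noteq> Gs (i - 1)"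

text \<open>Rounds \<open>i + 1, \<dots>, i + r - 1\<close> are free of changes.\<close>

definition quiet_after :: "nat \<Rightarrow> (nat \<Rightarrow> nat pair_pre_digraph) \<Rightarrow> nat \<Rightarrow> bool" where
  "quiet_after r Gs i \<longleftrightarrow> (\<forall>j. i < j \<and> j < i + r \<longrightarrow> \<not> change_at Gs j)"

definition r_round_promise :: "nat \<Rightarrow> (nat \<Rightarrow> nat pair_pre_digraph) \<Rightarrow> bool" where
  "r_round_promise r Gs \<longleftrightarrow> (\<forall>i. change_at Gs i \<longrightarrow> quiet_after r Gs i)"

text \<open>
  What a node observes in one round: its current neighbor list and the message received from each
  current neighbor. The state of a node is, without loss of generality, its entire local history
  (chronological list of observations) together with its own ID and the initial graph. A
  deterministic algorithm is therefore a pair of functions of these data. When sending, a node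
  already knows its neighbor list of the current round, and it may send different messages to
  different neighbors (last argument of \<open>send\<close>). As the algorithm may depend on the number of nodes,
  the round bound and the bandwidth, these are no arguments here.
\<close>

type_synonym observation = "nat set \<times> (nat \<rightharpoonup> bool list)"

record algorithm =
  send :: "nat \<Rightarrow> nat pair_pre_digraph \<Rightarrow> observation list \<Rightarrow> nat set \<Rightarrow> nat \<Rightarrow> bool list"
  out :: "nat \<Rightarrow> nat pair_pre_digraph \<Rightarrow> observation list \<Rightarrow> nat pair_pre_digraph set"

text \<open>Local history of node \<open>v\<close> at the end of a round.\<close>

primrec history ::
  "algorithm \<Rightarrow> (nat \<Rightarrow> nat pair_pre_digraph) \<Rightarrow> nat \<Rightarrow> nat \<Rightarrow> observation list" where
  "history A Gs 0 v = []"
| "history A Gs (Suc i) v = history A Gs i v @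
     [(neighbors (Gs (Suc i)) v,
       \<lambda>u. if u \<in> neighbors (Gs (Suc i)) v
           then Some (send A u (Gs 0) (history A Gs i u) (neighbors (Gs (Suc i)) u) v)
           else None)]"

definition has_bandwidth :: "algorithm \<Rightarrow> nat \<Rightarrow> bool" where
  "has_bandwidth A B \<longleftrightarrow> (\<forall>v G0 h N u. length (send A v G0 h N u) = B)"

text \<open>The required output of \<open>v\<close> in \<open>MemList(H)\<close>; subgraphs need not be induced.\<close>

definition mem_list :: "'a pair_pre_digraph \<Rightarrow> nat pair_pre_digraph \<Rightarrow> nat
    \<Rightarrow> nat pair_pre_digraph set" where
  "mem_list H G v = {S. subgraph (with_proj S) (with_proj G) \<and>
     digraph_iso (with_proj H) (with_proj S) \<and> v \<in> pverts S}"

text \<open>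
  Correctness is demanded for every \<open>i\<close> that is followed by \<open>r - 1\<close> change-free rounds. Besides the
  rounds in which a change occurs this covers the initial graph, and it forces the output to stay
  correct until the next change.
\<close>

definition r_round_MemList :: "nat \<Rightarrow> 'a pair_pre_digraph \<Rightarrow> nat \<Rightarrow> algorithm \<Rightarrow> bool" where
  "r_round_MemList r H n A \<longleftrightarrow>
     (\<forall>Gs. node_deletion_sequence n Gs \<and> r_round_promise r Gs \<longrightarrow>
       (\<forall>i. quiet_after r Gs i \<longrightarrow>
         (\<forall>v \<in> pverts (Gs i).
            out A v (Gs 0) (history A Gs (i + r - 1) v) = mem_list H (Gs i) v)))"

text \<open>The value is \<open>\<infinity>\<close> if no algorithm exists.\<close>

definition bandwidth_complexity :: "nat \<Rightarrow> 'a pair_pre_digraph \<Rightarrow> nat \<Rightarrow> enat" where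
  "bandwidth_complexity r H n =
     (INF B \<in> {B. \<exists>A. has_bandwidth A B \<and> r_round_MemList r H n A}. enat B)"

end

theory Submission
  imports Defs
begin

text \<open>
  Let \<open>D\<close> be the diameter of \<open>H\<close>, but at least 2. Time is divided into globally aligned phases of
  \<open>p = (r + 1) div D\<close> rounds, and in each phase every node transmits one message of \<open>p * B\<close> bits,
  that is, of order \<open>log n\<close>. A node which finds a neighbor \<open>w\<close> missing at the start of a phase
  announces \<open>(w, 0)\<close>; on receipt of \<open>(w, j)\<close> it forwards \<open>(w, j + 1)\<close> in the next phase, as long as
  \<open>j + 1 \<le> D - 2\<close>. As \<open>D * p \<le> r + 1\<close>, every flood is over before the next deletion, so that no two
  floods compete for bandwidth. When the first node \<open>w\<close> of a copy of \<open>H\<close> is deleted, a shortest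
  walk inside the copy carries this information to each of its other nodes. Hence a node that
  discards the copies containing a node it knows to be deleted lists precisely the surviving ones.
\<close>

section \<open>Walks in a copy of the pattern graph\<close>

text \<open>Powers of the arc relation keep only endpoints and length of a walk, which makes it easy
  to carry along a vertex map and to split at its first step.\<close>

lemma awalk_imp_relpow:
  "pre_digraph.awalk (with_proj G) u p v \<Longrightarrow> (u, v) \<in> parcs G ^^ length p"
proof (induction p arbitrary: u)
  case Nil
  then show ?case
    by (simp add: pre_digraph.awalk_def pre_digraph.cas.simps)
next
  case (Cons e p)
  then have e: "fst e = u" "e \<in> parcs G" "set p \<subseteq> parcs G"
    and cas: "pre_digraph.cas (with_proj G) (snd e) p v"
    by (auto simp: pre_digraph.awalk_def pre_digraph.cas.simps)
  have "pcas x q v \<Longrightarrow> set q \<subseteq> parcs G \<Longrightarrow> (x, v) \<in> parcs G ^^ length q" for x q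
  proof (induction q arbitrary: x)
    case (Cons a q)
    then have "(x, snd a) \<in> parcs G" "(snd a, v) \<in> parcs G ^^ length q"
      by auto
    then show ?case
      unfolding length_Cons by (rule relpow_Suc_I2)
  qed simp
  then have "(snd e, v) \<in> parcs G ^^ length p"
    using cas e(3) by (simp add: cas_with_proj_eq)
  then show ?case
    using e by (metis length_Cons prod.collapse relpow_Suc_I2)
qed

lemma relpow_le_diam:
  assumes "pair_graph H" "Digraph_Component.connected (with_proj H)"
    and u: "u \<in> pverts H" and v: "v \<in> pverts H"
  shows "\<exists>d \<le> diam H. (u, v) \<in> parcs H ^^ d"
proof -
  interpret pair_graph H by fact
  have "\<exists>p. pre_digraph.awalk (with_proj H) u p v"
    using symmetric_connected_imp_strongly_connected[OF pair_sym_arcs assms(2)] u v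
    by (auto simp: strongly_connected_def reachable_awalk)
  then have "\<exists>k p. pre_digraph.awalk (with_proj H) u p v \<and> length p = k"
    by blast
  then have "\<exists>p. pre_digraph.awalk (with_proj H) u p v \<and> length p = graph_dist H u v"
    unfolding graph_dist_def by (rule LeastI_ex)
  then have "(u, v) \<in> parcs H ^^ graph_dist H u v"
    using awalk_imp_relpow by metis
  moreover have "graph_dist H u v \<le> diam H"
  proof -
    have "{graph_dist H u v |u v. u \<in> pverts H \<and> v \<in> pverts H}
        = (\<lambda>(u, v). graph_dist H u v) ` (pverts H \<times> pverts H)"
      by auto
    then show ?thesis
      unfolding diam_def using u v pair_finite_verts by (intro Max_ge) auto
  qed
  ultimately show ?thesis
    by blast
qed

text \<open>Arcs are pairs of endpoints, so compatibility with \<open>tail\<close> and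
  \<open>head\<close> forces the arc map to be the one induced by the vertex map.\<close>

lemma digraph_isoE:
  assumes "digraph_iso (with_proj H) (with_proj S)"
  obtains f where "inj_on f (pverts H)" "pverts S = f ` pverts H"
    "\<And>x y. (x, y) \<in> parcs H \<Longrightarrow> (f x, f y) \<in> parcs S"
proof -
  obtain g where g: "pre_digraph.digraph_isomorphism (with_proj H) g"
    and S: "with_proj S = app_iso g (with_proj H)"
    using assms unfolding digraph_iso_def by blast
  have eqs: "pverts S = iso_verts g ` pverts H" "parcs S = iso_arcs g ` parcs H"
    "iso_tail g = fst" "iso_head g = snd"
    using arg_cong[OF S, of verts] arg_cong[OF S, of arcs]
      arg_cong[OF S, of tail] arg_cong[OF S, of head] by simp_all
  have "(iso_verts g x, iso_verts g y) = iso_arcs g (x, y)" if "(x, y) \<in> parcs H" for x y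
    using g that eqs(3,4) by (fastforce simp: pre_digraph.digraph_isomorphism_def prod_eq_iff)
  then have "(iso_verts g x, iso_verts g y) \<in> parcs S" if "(x, y) \<in> parcs H" for x y
    using that eqs(2) by simp
  moreover have "inj_on (iso_verts g) (pverts H)"
    using g by (simp add: pre_digraph.digraph_isomorphism_def)
  ultimately show ?thesis
    using that eqs(1) by blast
qed

lemma card_pverts_digraph_iso:
  "digraph_iso (with_proj H) (with_proj S) \<Longrightarrow> card (pverts S) = card (pverts H)"
  by (elim digraph_isoE) (simp add: card_image)

lemma relpow_map:
  assumes "(x, y) \<in> R ^^ d" "\<And>x y. (x, y) \<in> R \<Longrightarrow> (f x, f y) \<in> Q"
  shows "(f x, f y) \<in> Q ^^ d"
  using assms(1)
proof (induction d arbitrary: y)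
  case (Suc d)
  then obtain z where "(x, z) \<in> R ^^ d" "(z, y) \<in> R"
    by auto
  then show ?case
    using Suc.IH assms(2) by (auto intro: relcompI)
qed simp

text \<open>The walk stays inside the copy \<open>S\<close>, so deletions outside \<open>S\<close>
  cannot interrupt it.\<close>

lemma relpow_le_diam_iso:
  assumes "pair_graph H" "Digraph_Component.connected (with_proj H)"
    and iso: "digraph_iso (with_proj H) (with_proj S)"
    and "u \<in> pverts S" "v \<in> pverts S"
  shows "\<exists>d \<le> diam H. (u, v) \<in> parcs S ^^ d"
proof -
  obtain f where f: "pverts S = f ` pverts H"
    "\<And>x y. (x, y) \<in> parcs H \<Longrightarrow> (f x, f y) \<in> parcs S"
    using digraph_isoE[OF iso] by metis
  then obtain a b where "a \<in> pverts H" "b \<in> pverts H" "u = f a" "v = f b"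
    using assms by auto
  then show ?thesis
    using relpow_le_diam[OF assms(1,2)] relpow_map[where f = f] f(2) by metis
qed

section \<open>Sequences of node deletions\<close>

locale deletions =
  fixes n :: nat and Gs :: "nat \<Rightarrow> nat pair_pre_digraph"
  assumes deletion_sequence: "node_deletion_sequence n Gs"
begin

lemma pverts_0: "pverts (Gs 0) = {1..n}"
  using deletion_sequence by (simp add: node_deletion_sequence_def)

lemma step_cases:
  obtains "Gs (Suc i) = Gs i"
  | w where "w \<in> pverts (Gs i)" "pverts (Gs (Suc i)) = pverts (Gs i) - {w}"
    "parcs (Gs (Suc i)) = {a \<in> parcs (Gs i). fst a \<noteq> w \<and> snd a \<noteq> w}"
proof -
  consider "Gs (Suc i) = Gs i"
    | w where "w \<in> pverts (Gs i)"
      "with_proj (Gs (Suc i)) = pre_digraph.del_vert (with_proj (Gs i)) w"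
    using deletion_sequence unfolding node_deletion_sequence_def by blast
  then show ?thesis
  proof cases
    case 1
    then show ?thesis by (rule that(1))
  next
    case (2 w)
    show ?thesis
    proof (rule that(2))
      show "w \<in> pverts (Gs i)" by fact
      show "pverts (Gs (Suc i)) = pverts (Gs i) - {w}"
        using arg_cong[OF 2(2), of verts] by (simp add: pre_digraph.del_vert_def)
      show "parcs (Gs (Suc i)) = {a \<in> parcs (Gs i). fst a \<noteq> w \<and> snd a \<noteq> w}"
        using arg_cong[OF 2(2), of arcs] by (simp add: pre_digraph.del_vert_def)
    qed
  qed
qed

lemma pverts_antimono: "i \<le> j \<Longrightarrow> pverts (Gs j) \<subseteq> pverts (Gs i)"
proof (induction j rule: dec_induct)
  case (step j)
  then show ?case by (cases rule: step_cases[of j]) auto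
qed simp

lemma parcs_0_subset: "parcs (Gs 0) \<subseteq> pverts (Gs 0) \<times> pverts (Gs 0)"
proof -
  interpret pair_graph "Gs 0"
    using deletion_sequence by (simp add: node_deletion_sequence_def)
  show ?thesis
    using wellformed' by auto
qed

text \<open>A deletion removes exactly the incident arcs. Hence each graph is induced by its
  surviving nodes, and later arguments track vertex sets only.\<close>

lemma parcs_eq: "parcs (Gs i) = parcs (Gs 0) \<inter> pverts (Gs i) \<times> pverts (Gs i)"
proof (induction i)
  case 0
  then show ?case using parcs_0_subset by blast
next
  case (Suc i)
  then show ?case by (cases rule: step_cases[of i]) auto
qed

lemma neighbors_eq: "u \<in> neighbors (Gs i) v \<longleftrightarrow>
    u \<in> neighbors (Gs 0) v \<and> u \<in> pverts (Gs i) \<and> v \<in> pverts (Gs i)"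
  by (auto simp: neighbors_def parcs_eq[of i])

lemma neighbors_antimono: "i \<le> j \<Longrightarrow> neighbors (Gs j) v \<subseteq> neighbors (Gs i) v"
  using pverts_antimono[of i j] by (auto simp: neighbors_eq[of _ i] neighbors_eq[of _ j])

lemma pair_wf_digraph_Gs: "pair_wf_digraph (Gs i)"
proof
  fix e
  assume "e \<in> parcs (Gs i)"
  then have "e \<in> pverts (Gs i) \<times> pverts (Gs i)"
    using parcs_eq[of i] by blast
  then show "fst e \<in> pverts (Gs i)" "snd e \<in> pverts (Gs i)"
    by (simp_all add: mem_Times_iff)
qed

text \<open>No deletion creates a copy, and a copy is lost only with one of its vertices. So the
  output can be found by filtering the copies of the initial graph.\<close>

lemma mem_list_eq:
  "mem_list H (Gs i) v = {S \<in> mem_list H (Gs 0) v. pverts S \<subseteq> pverts (Gs i)}"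
proof -
  have "subgraph (with_proj S) (with_proj (Gs i)) \<longleftrightarrow>
      subgraph (with_proj S) (with_proj (Gs 0)) \<and> pverts S \<subseteq> pverts (Gs i)" (is "?L \<longleftrightarrow> ?R") for S
  proof
    assume ?L
    then show ?R
      using pverts_antimono[of 0 i] pair_wf_digraph_Gs[of 0] parcs_eq[of i]
      by (auto simp: subgraph_def compatible_def wf_digraph_wp_iff)
  next
    assume R: ?R
    then have "pair_wf_digraph S"
      by (simp add: subgraph_def wf_digraph_wp_iff)
    then have "parcs S \<subseteq> pverts S \<times> pverts S"
      by (auto simp: pair_wf_digraph_def)
    then show ?L
      using R pair_wf_digraph_Gs[of i] parcs_eq[of i]
      by (auto simp: subgraph_def compatible_def wf_digraph_wp_iff)
  qed
  then show ?thesis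
    by (auto simp: mem_list_def)
qed

lemma deletion_round:
  assumes "w \<in> pverts (Gs i)" "w \<notin> pverts (Gs j)"
  obtains l where "i < l" "l \<le> j" "change_at Gs l" "pverts (Gs l) = pverts (Gs (l - 1)) - {w}"
    "w \<in> pverts (Gs (l - 1))"
proof -
  define l where "l = (LEAST l. w \<notin> pverts (Gs l))"
  have l: "w \<notin> pverts (Gs l)" "l \<le> j" "\<And>m. m < l \<Longrightarrow> w \<in> pverts (Gs m)"
    using LeastI[of "\<lambda>l. w \<notin> pverts (Gs l)" j] Least_le[of "\<lambda>l. w \<notin> pverts (Gs l)" j]
      not_less_Least[of _ "\<lambda>l. w \<notin> pverts (Gs l)"] assms(2) unfolding l_def by blast+
  have il: "i < l"
    using l(1) assms(1) pverts_antimono[of l i] by (meson in_mono not_le_imp_less)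
  then obtain m where m: "l = Suc m"
    by (cases l) auto
  then have wm: "w \<in> pverts (Gs m)"
    using l(3) by simp
  have "pverts (Gs l) = pverts (Gs m) - {w}"
    using l(1) wm unfolding m by (cases rule: step_cases[of m]) auto
  moreover have "change_at Gs l"
    using l(1) wm unfolding change_at_def m by auto
  ultimately show ?thesis
    using that[of l] il l(2) wm m by simp
qed

lemma quiet_after_eq:
  assumes "quiet_after r Gs i" "i \<le> j" "j < i + r"
  shows "Gs j = Gs i"
  using assms(2,3)
proof (induction j rule: dec_induct)
  case (step j)
  then have "\<not> change_at Gs (Suc j)"
    using assms(1) by (simp add: quiet_after_def)
  then show ?case
    using step by (simp add: change_at_def)
qed simp

text \<open>At most \<open>r\<close> rounds lie after \<open>x\<close> and up to \<open>y\<close>,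
  and the first change among them forbids changes in the next \<open>r - 1\<close>. So one change
  fits, and it removes one node.\<close>

lemma deletion_unique:
  assumes promise: "r_round_promise r Gs" and le: "y \<le> x + r"
    and a: "a \<in> pverts (Gs x)" "a \<notin> pverts (Gs y)"
    and b: "b \<in> pverts (Gs x)" "b \<notin> pverts (Gs y)"
  shows "a = b"
proof -
  obtain l where l: "x < l" "l \<le> y" "change_at Gs l" "pverts (Gs l) = pverts (Gs (l - 1)) - {a}"
    "a \<in> pverts (Gs (l - 1))"
    using deletion_round[OF a] .
  obtain m where m: "x < m" "m \<le> y" "change_at Gs m" "pverts (Gs m) = pverts (Gs (m - 1)) - {b}"
    "b \<in> pverts (Gs (m - 1))"
    using deletion_round[OF b] .
  have "quiet_after r Gs l" "quiet_after r Gs m"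
    using promise l(3) m(3) by (auto simp: r_round_promise_def)
  then have "l = m"
    using l m le unfolding quiet_after_def
    by (metis add_less_cancel_right le_less_trans linorder_neqE_nat order_le_less_trans)
  then show ?thesis
    using l m by auto
qed

end

section \<open>Flooding in phases\<close>

text \<open>\<open>None\<close> stands for silence. For a living node the choice is no real one,
  since \<open>news_unique\<close> leaves at most one candidate.\<close>

definition pick :: "'b set \<Rightarrow> 'b option" where
  "pick X = (if X = {} then None else Some (SOME x. x \<in> X))"

lemma pick_SomeD: "pick X = Some x \<Longrightarrow> x \<in> X"
  by (auto simp: pick_def some_in_eq split: if_splits)

text \<open>
  Phase \<open>k\<close> consists of the rounds \<open>k * p + 1, \<dots>, k * p + p\<close>. Its first round is \<open>sample p (Suc k)\<close>,
  so that it handles the deletions in the rounds after \<open>sample p k\<close> up to \<open>sample p (Suc k)\<close>.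
\<close>

primrec sample :: "nat \<Rightarrow> nat \<Rightarrow> nat" where
  "sample p 0 = 0"
| "sample p (Suc k) = Suc (k * p)"

lemma sample_mono: "k \<le> l \<Longrightarrow> sample p k \<le> sample p l"
  by (cases k; cases l) auto

text \<open>For \<open>k > 0\<close>, a deletion handled in phase \<open>k\<close> happens in round
  \<open>(k - 1) * p + 2\<close> at the earliest. The phases \<open>k, ..., k + D - 2\<close> end
  with round \<open>(k + D - 1) * p\<close>; this precedes the next possible change because
  \<open>D * p \<le> r + 1\<close>.\<close>

locale flooding = deletions +
  fixes r p D :: nat
  assumes promise: "r_round_promise r Gs"
    and p_pos: "p \<ge> 1" and D_ge: "D \<ge> 2" and budget: "D * p \<le> Suc r"
begin

text \<open>
  The pairs a node may send in phase \<open>k\<close>: \<open>(w, j)\<close> announces the deletion of \<open>w\<close>, detected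
  \<open>j\<close> phases before. Restricting \<open>j\<close> to at most \<open>D - 2\<close> ends the flooding before the next change.
\<close>

primrec news :: "nat \<Rightarrow> nat \<Rightarrow> (nat \<times> nat) set" where
  "news 0 v = {(w, 0) |w. w \<in> neighbors (Gs (sample p 0)) v - neighbors (Gs (sample p 1)) v}"
| "news (Suc k) v =
     {(w, 0) |w. w \<in> neighbors (Gs (sample p (Suc k))) v - neighbors (Gs (sample p (Suc (Suc k)))) v} \<union>
     {(w, Suc j) |w j. Suc j \<le> D - 2 \<and>
        (\<exists>u \<in> neighbors (Gs (Suc k * p)) v. pick (news k u) = Some (w, j))}"

lemma news_detect:
  "w \<in> neighbors (Gs (sample p k)) v - neighbors (Gs (sample p (Suc k))) v \<Longrightarrow> (w, 0) \<in> news k v"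
  by (cases k) auto

text \<open>The tag \<open>j\<close> dates the deletion to the interval handled by phase
  \<open>k - j\<close>. That \<open>v\<close> is alive matters: a deleted node has an empty neighbor
  list and would seem to have lost all its neighbors.\<close>

lemma news_sound:
  "(w, j) \<in> news k v \<Longrightarrow> v \<in> pverts (Gs (sample p (Suc k))) \<Longrightarrow>
     j \<le> k \<and> j \<le> D - 2 \<and> w \<in> pverts (Gs (sample p (k - j))) \<and>
     w \<notin> pverts (Gs (sample p (Suc (k - j))))"
proof (induction k arbitrary: v w j)
  case 0
  have "w \<in> neighbors (Gs 0) v - neighbors (Gs (sample p 1)) v" "j = 0"
    using 0(1) by auto
  then show ?case
    using 0(2) parcs_0_subset neighbors_eq[of w "sample p 1" v] by (auto simp: neighbors_def)
next
  case (Suc k)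
  show ?case
  proof (cases j)
    case 0
    then have "w \<in> neighbors (Gs (sample p (Suc k))) v - neighbors (Gs (sample p (Suc (Suc k)))) v"
      using Suc.prems(1) by auto
    then show ?thesis
      using 0 Suc.prems(2) neighbors_eq[of w "sample p (Suc k)" v]
        neighbors_eq[of w "sample p (Suc (Suc k))" v] by simp
  next
    case j: (Suc i)
    then obtain u where u: "j \<le> D - 2" "u \<in> neighbors (Gs (Suc k * p)) v"
      "pick (news k u) = Some (w, i)"
      using Suc.prems(1) by auto
    have "sample p (Suc k) \<le> Suc k * p"
      using p_pos by simp
    then have "u \<in> pverts (Gs (sample p (Suc k)))"
      using u(2) neighbors_eq[of u "Suc k * p" v] pverts_antimono by blast
    from Suc.IH[OF pick_SomeD[OF u(3)] this] show ?thesis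
      using u(1) j by simp
  qed
qed

text \<open>A window of \<open>D - 1\<close> phases is no longer than \<open>r\<close>, hence contains at most one deletion.\<close>

lemma news_unique:
  assumes "(w1, j1) \<in> news k v1" "v1 \<in> pverts (Gs (sample p (Suc k)))"
    and "(w2, j2) \<in> news k v2" "v2 \<in> pverts (Gs (sample p (Suc k)))"
  shows "(w1, j1) = (w2, j2)"
proof -
  have 1: "j1 \<le> k" "j1 \<le> D - 2" "w1 \<in> pverts (Gs (sample p (k - j1)))"
    "w1 \<notin> pverts (Gs (sample p (Suc (k - j1))))"
    using news_sound[OF assms(1,2)] by auto
  have 2: "j2 \<le> k" "j2 \<le> D - 2" "w2 \<in> pverts (Gs (sample p (k - j2)))"
    "w2 \<notin> pverts (Gs (sample p (Suc (k - j2))))"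
    using news_sound[OF assms(3,4)] by auto
  have window: "w \<in> pverts (Gs (sample p (k - (D - 2)))) \<and> w \<notin> pverts (Gs (sample p (Suc k)))"
    if "j \<le> k" "j \<le> D - 2" "w \<in> pverts (Gs (sample p (k - j)))"
      "w \<notin> pverts (Gs (sample p (Suc (k - j))))" for w j
  proof -
    have "sample p (k - (D - 2)) \<le> sample p (k - j)" "sample p (Suc (k - j)) \<le> sample p (Suc k)"
      by (rule sample_mono, use that in linarith)+
    then show ?thesis
      using that(3,4) pverts_antimono by blast
  qed
  \<comment> \<open>Subtraction is truncated: if \<open>k \<le> D - 2\<close>, the window starts at
    round 0 and ends by round \<open>(D - 2) * p + 1\<close>; otherwise its length is
    \<open>(D - 1) * p\<close>.\<close>
  have "sample p (Suc k) \<le> sample p (k - (D - 2)) + r"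
  proof -
    obtain E where E: "D = Suc (Suc E)"
      using D_ge by (metis add_2_eq_Suc le_Suc_ex)
    have Er: "E * p + p \<le> r"
      using budget p_pos unfolding E by simp
    show ?thesis
    proof (cases "k - E")
      case 0
      then have "k * p \<le> E * p"
        by (intro mult_le_mono1) simp
      then have "Suc (k * p) \<le> r"
        using Er p_pos by linarith
      then show ?thesis
        using 0 E by simp
    next
      case (Suc l)
      then have k: "k = l + Suc E"
        by linarith
      have "k * p = l * p + (E * p + p)"
        unfolding k by (simp add: add_mult_distrib)
      then show ?thesis
        using Er Suc E by simp
    qed
  qed
  then have w: "w1 = w2"
    using deletion_unique[OF promise] window[OF 1] window[OF 2] by blast
  \<comment> \<open>A node is deleted only once, and different phases handle disjoint intervals of
    rounds, so its tag is determined.\<close>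
  have "\<not> i < j" if "w \<in> pverts (Gs (sample p (k - i)))" "w \<notin> pverts (Gs (sample p (Suc (k - j))))"
    "j \<le> k" for w i j
  proof
    assume "i < j"
    then have "sample p (Suc (k - j)) \<le> sample p (k - i)"
      using that(3) by (intro sample_mono) linarith
    then show False
      using that pverts_antimono by blast
  qed
  then have "j1 = j2"
    using 1 2 w by (metis linorder_neqE_nat)
  then show ?thesis
    using w by simp
qed

lemma pick_news:
  assumes "x \<in> news k v" "v \<in> pverts (Gs (sample p (Suc k)))"
  shows "pick (news k v) = Some x"
proof -
  have "pick (news k v) \<noteq> None"
    using assms(1) by (auto simp: pick_def)
  then obtain y where y: "pick (news k v) = Some y"
    by auto
  then have "y = x"
    using news_unique[of "fst y" "snd y" k v "fst x" "snd x" v] pick_SomeD[OF y] assms by simp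
  then show ?thesis
    using y by simp
qed

text \<open>Missing neighbors are noticed in the current round, without waiting for the next phase,
  whereas a message counts only once its phase is complete.\<close>

definition heard :: "nat \<Rightarrow> nat \<Rightarrow> nat set" where
  "heard t v = (neighbors (Gs 0) v - neighbors (Gs t) v) \<union>
     {w. \<exists>k u j. k * p + p \<le> t \<and> u \<in> neighbors (Gs (k * p + p)) v \<and> pick (news k u) = Some (w, j)}"

lemma heard_sound:
  assumes "w \<in> heard t v" "v \<in> pverts (Gs t)"
  shows "w \<notin> pverts (Gs t)"
proof (cases "w \<in> neighbors (Gs 0) v - neighbors (Gs t) v")
  case True
  then show ?thesis
    using assms(2) neighbors_eq[of w t v] by blast
next
  case False
  then obtain k u j where k: "k * p + p \<le> t" "u \<in> neighbors (Gs (k * p + p)) v"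
    "pick (news k u) = Some (w, j)"
    using assms(1) by (auto simp: heard_def)
  have s: "sample p (Suc k) \<le> k * p + p"
    using p_pos by simp
  have "u \<in> pverts (Gs (sample p (Suc k)))"
    using neighbors_eq[of u "k * p + p" v] k(2) pverts_antimono[OF s] by blast
  then have "w \<notin> pverts (Gs (sample p (Suc (k - j))))"
    using news_sound[OF pick_SomeD[OF k(3)]] by blast
  moreover have "sample p (Suc (k - j)) \<le> t"
    using sample_mono[of "Suc (k - j)" "Suc k" p] s k(1) by linarith
  ultimately show ?thesis
    using pverts_antimono by blast
qed

text \<open>Induction on the number \<open>j\<close> of elapsed phases: a node with a walk of length
  at most \<open>j + 1\<close> to \<open>w\<close> either detects the loss itself or hears it from
  the next node of the walk. It may learn of it early, hence \<open>j' \<le> j\<close>.\<close>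

lemma flood_reaches:
  assumes S: "parcs S \<subseteq> parcs (Gs (sample p k))" "parcs S \<subseteq> pverts S \<times> pverts S"
    and alive: "pverts S - {w} \<subseteq> pverts (Gs i)"
    and dead: "w \<notin> pverts (Gs i)"
    and i: "i \<le> sample p (Suc k)"
    and quiet: "\<And>t. i \<le> t \<Longrightarrow> t \<le> (k + D - 1) * p \<Longrightarrow> Gs t = Gs i"
  shows "j \<le> D - 2 \<Longrightarrow> x \<in> pverts S - {w} \<Longrightarrow> d \<le> Suc j \<Longrightarrow> (x, w) \<in> parcs S ^^ d \<Longrightarrow>
     \<exists>j' \<le> j. (w, j') \<in> news (k + j') x"
proof (induction j arbitrary: x d)
  case 0
  have "d = 1"
    using 0 by (cases d) auto
  then have xw: "(x, w) \<in> parcs S"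
    using 0 by simp
  have "w \<in> neighbors (Gs (sample p k)) x"
    using xw S by (auto simp: neighbors_def)
  moreover have "w \<notin> neighbors (Gs (sample p (Suc k))) x"
    using neighbors_eq[of w "sample p (Suc k)" x] dead pverts_antimono[OF i] by blast
  ultimately show ?case
    using news_detect by auto
next
  case (Suc j)
  show ?case
  proof (cases "d \<le> Suc j")
    case True
    then show ?thesis
      using Suc.IH[of x d] Suc.prems by (meson Suc_leD le_SucI)
  next
    case False
    then have "d = Suc (Suc j)"
      using Suc.prems by simp
    then obtain y where y: "(x, y) \<in> parcs S" "(y, w) \<in> parcs S ^^ Suc j"
      using Suc.prems(4) relpow_Suc_D2 by metis
    show ?thesis
    \<comment> \<open>The walk need not be a shortest one and may run through \<open>w\<close>
      before its end; then \<open>x\<close> is itself a neighbor of \<open>w\<close>.\<close>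
    proof (cases "y = w")
      case True
      have "w \<in> neighbors (Gs (sample p k)) x"
        using y S True by (auto simp: neighbors_def)
      moreover have "w \<notin> neighbors (Gs (sample p (Suc k))) x"
        using neighbors_eq[of w "sample p (Suc k)" x] dead pverts_antimono[OF i] by blast
      ultimately show ?thesis
        using news_detect by auto
    next
      case False
      then have yS: "y \<in> pverts S - {w}"
        using y S by auto
      obtain j' where j': "j' \<le> j" "(w, j') \<in> news (k + j') y"
        using Suc.IH[OF _ yS _ y(2)] Suc.prems(1) by auto
      \<comment> \<open>The last round of phase \<open>k + j'\<close>, whose neighbor list decides
        in \<open>news\<close> which messages are used.\<close>
      define t where "t = Suc (k + j') * p"
      have "(k + j') * p + 1 \<le> t"
        using p_pos by (simp add: t_def)
      moreover have "i \<le> (k + j') * p + 1"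
        using i by (simp add: add_mult_distrib)
      moreover have "t \<le> (k + D - 1) * p"
        unfolding t_def using j'(1) Suc.prems(1) D_ge by (intro mult_le_mono1) linarith
      ultimately have Gs_t: "Gs t = Gs i" "Gs (sample p (Suc (k + j'))) = Gs i"
        using quiet[of t] quiet[of "sample p (Suc (k + j'))"] by simp_all
      have "pick (news (k + j') y) = Some (w, j')"
        using pick_news[OF j'(2)] Gs_t(2) alive yS by auto
      moreover have "y \<in> neighbors (Gs t) x"
      proof -
        have "y \<in> neighbors (Gs 0) x"
          using y S neighbors_eq[of y "sample p k" x] by (auto simp: neighbors_def)
        then show ?thesis
          using neighbors_eq[of y t x] Gs_t alive yS Suc.prems(2) by auto
      qed
      ultimately have "(w, Suc j') \<in> news (Suc (k + j')) x"
        using j'(1) Suc.prems(1) unfolding t_def by (auto intro!: exI[of _ y] bexI[of _ y])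
      then show ?thesis
        using j'(1) by (intro exI[of _ "Suc j'"]) simp
    qed
  qed
qed

text \<open>
  If some node of the copy \<open>S\<close> is missing, then the first deleted one becomes known to \<open>v\<close>: at that
  time, the walks of length at most \<open>D\<close> to it within \<open>S\<close> are otherwise intact.
\<close>

lemma heard_complete:
  assumes S: "parcs S \<subseteq> parcs (Gs 0)" "parcs S \<subseteq> pverts S \<times> pverts S" "pverts S \<subseteq> pverts (Gs 0)"
    and walks: "\<And>x y. x \<in> pverts S \<Longrightarrow> y \<in> pverts S \<Longrightarrow> \<exists>d \<le> D. (x, y) \<in> parcs S ^^ d"
    and quiet0: "quiet_after r Gs i0" and r: "r \<ge> 1" and t: "t = i0 + r - 1"
    and v: "v \<in> pverts S" "v \<in> pverts (Gs t)"
    and missing: "\<not> pverts S \<subseteq> pverts (Gs t)"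
  shows "pverts S \<inter> heard t v \<noteq> {}"
proof -
  have Gt: "Gs t = Gs i0"
    using quiet_after_eq[OF quiet0, of t] r t by simp
  define i where "i = (LEAST i. \<not> pverts S \<subseteq> pverts (Gs i))"
  have i: "\<not> pverts S \<subseteq> pverts (Gs i)" "i \<le> i0" "\<And>m. m < i \<Longrightarrow> pverts S \<subseteq> pverts (Gs m)"
    using LeastI[of "\<lambda>i. \<not> pverts S \<subseteq> pverts (Gs i)" i0]
      Least_le[of "\<lambda>i. \<not> pverts S \<subseteq> pverts (Gs i)" i0]
      not_less_Least[of _ "\<lambda>i. \<not> pverts S \<subseteq> pverts (Gs i)"] missing
    unfolding Gt i_def by blast+
  obtain m where m: "i = Suc m"
    using i(1) S(3) by (cases i) auto
  have Sm: "pverts S \<subseteq> pverts (Gs m)"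
    using i(3) m by simp
  obtain w where w: "w \<in> pverts S" "w \<notin> pverts (Gs i)"
    using i(1) by auto
  \<comment> \<open>Each round removes at most one node, so at the first damage to \<open>S\<close>
    only \<open>w\<close> is missing.\<close>
  have alive: "pverts S - {w} \<subseteq> pverts (Gs i)"
    using w Sm unfolding m by (cases rule: step_cases[of m]) auto
  have "change_at Gs i"
    using w Sm unfolding m change_at_def by auto
  then have "quiet_after r Gs i"
    using promise by (simp add: r_round_promise_def)
  note quiet_i = quiet_after_eq[OF this]
  \<comment> \<open>The phase that handles the deletion: the earliest one whose first round is not
    before \<open>i\<close>.\<close>
  define k where "k = (LEAST k. i \<le> sample p (Suc k))"
  have "i \<le> sample p (Suc i)"
    using p_pos by (simp add: le_Suc_eq trans_le_add1)
  then have ik: "i \<le> sample p (Suc k)"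
    unfolding k_def by (rule LeastI)
  have ki: "sample p k \<le> m"
  proof (cases k)
    case (Suc l)
    then have "\<not> i \<le> sample p (Suc l)"
      unfolding k_def by (metis lessI not_less_Least)
    then show ?thesis
      using Suc m by simp
  qed simp
  have end_i: "(k + D - 1) * p < i + r"
  proof -
    obtain E where E: "D = Suc (Suc E)"
      using D_ge by (metis add_2_eq_Suc le_Suc_ex)
    show ?thesis
    proof (cases k)
      case 0
      then show ?thesis
        using budget p_pos m E by simp
    next
      case (Suc l)
      then have "Suc (l * p) < i"
        using ki m by simp
      moreover have "(k + D - 1) * p = l * p + D * p"
        using Suc E by (simp add: algebra_simps)
      ultimately show ?thesis
        using budget by linarith
    qed
  qed
  have quiet: "Gs s = Gs i" if "i \<le> s" "s \<le> (k + D - 1) * p" for s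
    using quiet_i[of s] that end_i by simp
  have Sk: "parcs S \<subseteq> parcs (Gs (sample p k))"
    using S(1,2) parcs_eq[of "sample p k"] Sm pverts_antimono[OF ki] by blast
  have vw: "v \<noteq> w"
    using v w pverts_antimono[OF i(2)] unfolding Gt by blast
  obtain d where d: "d \<le> D" "(v, w) \<in> parcs S ^^ d"
    using walks v(1) w(1) by blast
  have "d \<noteq> 0"
    using d(2) vw by (cases d) auto
  \<comment> \<open>The node \<open>v\<close> only has to listen. Its successor \<open>y\<close> has
    a walk of length at most \<open>D - 1\<close> to \<open>w\<close>, so tags up to
    \<open>D - 2\<close> suffice.\<close>
  then obtain e where e: "d = Suc e"
    by (cases d) auto
  then obtain y where y: "(v, y) \<in> parcs S" "(y, w) \<in> parcs S ^^ e"
    using d(2) relpow_Suc_D2 by metis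
  have vy: "y \<in> neighbors (Gs 0) v"
    using y(1) S(1) by (auto simp: neighbors_def)
  have "w \<in> heard t v"
  proof (cases "y = w")
    case True
    have "w \<notin> neighbors (Gs t) v"
      using w(2) pverts_antimono[OF i(2)] neighbors_eq[of w t v] unfolding Gt by blast
    then show ?thesis
      using vy True by (simp add: heard_def)
  next
    case False
    then have yS: "y \<in> pverts S - {w}"
      using y(1) S(2) by auto
    have "e \<le> Suc (D - 2)"
      using d(1) e D_ge by simp
    from flood_reaches[OF Sk S(2) alive w(2) ik quiet le_refl yS this y(2)]
    obtain j where j: "j \<le> D - 2" "(w, j) \<in> news (k + j) y"
      by blast
    define s where "s = (k + j) * p + p"
    have "i \<le> sample p (Suc (k + j))"
      using ik by (simp add: add_mult_distrib)
    moreover have "sample p (Suc (k + j)) \<le> s"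
      using p_pos by (simp add: s_def)
    moreover have s: "s \<le> (k + D - 1) * p"
    proof -
      have "s = Suc (k + j) * p"
        by (simp add: s_def)
      also have "\<dots> \<le> (k + D - 1) * p"
        using j(1) D_ge by (intro mult_le_mono1) linarith
      finally show ?thesis .
    qed
    ultimately have Gs_s: "Gs s = Gs i" "Gs (sample p (Suc (k + j))) = Gs i"
      using quiet by (meson le_trans)+
    have "pick (news (k + j) y) = Some (w, j)"
      using pick_news[OF j(2)] Gs_s(2) alive yS by auto
    moreover have "y \<in> neighbors (Gs s) v"
      using neighbors_eq[of y s v] vy Gs_s(1) alive yS v(1) vw by auto
    moreover have "s \<le> t"
      using s end_i i(2) t by linarith
    ultimately show ?thesis
      unfolding heard_def s_def by blast
  qed
  then show ?thesis
    using w(1) by blast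
qed

end

section \<open>The distributed algorithm\<close>

lemma length_history [simp]: "length (history A Gs t v) = t"
  by (induction t) auto

lemma nth_history:
  "i < t \<Longrightarrow> history A Gs t v ! i = (neighbors (Gs (Suc i)) v,
     \<lambda>u. if u \<in> neighbors (Gs (Suc i)) v
         then Some (send A u (Gs 0) (history A Gs i u) (neighbors (Gs (Suc i)) u) v) else None)"
proof (induction t)
  case (Suc t)
  then show ?case
    by (cases "i < t") (auto simp: nth_append less_Suc_eq)
qed simp

lemma concat_chunks:
  "concat (map (\<lambda>q. take B (drop (q * B) xs)) [0..<p]) = take (p * B) xs"
proof (induction p)
  case (Suc p)
  have "Suc p * B = p * B + B"
    by simp
  then have "take (Suc p * B) xs = take (p * B) xs @ take B (drop (p * B) xs)"
    by (simp only: take_add)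
  then show ?case
    using Suc by simp
qed simp

text \<open>The observation of round \<open>i\<close> is at list position \<open>i - 1\<close>;
  round 0 has none and is read off the initial graph.\<close>

definition nbrs_at :: "nat pair_pre_digraph \<Rightarrow> observation list \<Rightarrow> nat \<Rightarrow> nat \<Rightarrow> nat set" where
  "nbrs_at G0 h v i = (if i = 0 then neighbors G0 v else fst (h ! (i - 1)))"

definition received ::
  "(bool list \<Rightarrow> (nat \<times> nat) option) \<Rightarrow> nat \<Rightarrow> observation list \<Rightarrow> nat \<Rightarrow> nat \<Rightarrow> (nat \<times> nat) option"
where
  "received dec p h k u = dec (concat (map (\<lambda>i. the (snd (h ! i) u)) [k * p..<k * p + p]))"

text \<open>Counterpart of \<open>news\<close> computable by \<open>v\<close> alone. It needs no
  recursion, as earlier news of others is decoded from the history; the guard \<open>k > 0\<close>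
  excludes the truncated \<open>k - 1\<close>.\<close>

definition local_news ::
  "(bool list \<Rightarrow> (nat \<times> nat) option) \<Rightarrow> nat \<Rightarrow> nat \<Rightarrow> nat pair_pre_digraph \<Rightarrow> observation list
     \<Rightarrow> nat \<Rightarrow> nat \<Rightarrow> (nat \<times> nat) set"
where
  "local_news dec p D G0 h v k =
     {(w, 0) |w. w \<in> nbrs_at G0 h v (sample p k) - nbrs_at G0 h v (sample p (Suc k))} \<union>
     {(w, Suc j) |w j. Suc j \<le> D - 2 \<and> k > 0 \<and>
        (\<exists>u \<in> nbrs_at G0 h v (k * p). received dec p h (k - 1) u = Some (w, j))}"

definition local_heard ::
  "(bool list \<Rightarrow> (nat \<times> nat) option) \<Rightarrow> nat \<Rightarrow> nat pair_pre_digraph \<Rightarrow> observation list \<Rightarrow> nat \<Rightarrow> nat set"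
where
  "local_heard dec p G0 h v = (neighbors G0 v - nbrs_at G0 h v (length h)) \<union>
     {w. \<exists>k u j. k * p + p \<le> length h \<and> u \<in> nbrs_at G0 h v (k * p + p) \<and>
        received dec p h k u = Some (w, j)}"

text \<open>
  The message of a phase is fixed by what is known in its first round, where the neighbor list of
  that round may only be available as the argument \<open>N\<close>; it is sent in pieces of \<open>B\<close> bits.
\<close>

definition flood_alg ::
  "nat \<Rightarrow> nat \<Rightarrow> nat \<Rightarrow> ((nat \<times> nat) option \<Rightarrow> bool list) \<Rightarrow> (bool list \<Rightarrow> (nat \<times> nat) option)
     \<Rightarrow> 'a pair_pre_digraph \<Rightarrow> algorithm"
where
  "flood_alg p B D enc dec H =
     \<lparr>send = (\<lambda>v G0 h N u. take B (drop ((length h mod p) * B)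
        (enc (pick (local_news dec p D G0 (h @ [(N, Map.empty)]) v (length h div p)))))),
      out = (\<lambda>v G0 h. {S \<in> mem_list H G0 v. pverts S \<inter> local_heard dec p G0 h v = {}})\<rparr>"

section \<open>Local histories reproduce the global flood\<close>

context flooding
begin

context
  fixes B :: nat and enc :: "(nat \<times> nat) option \<Rightarrow> bool list"
    and dec :: "bool list \<Rightarrow> (nat \<times> nat) option" and H :: "'a pair_pre_digraph" and A :: algorithm
  assumes length_enc: "\<And>x. length (enc x) = p * B"
    and dec_enc: "\<And>x. x \<in> insert None (Some ` ({1..n} \<times> {..<D})) \<Longrightarrow> dec (enc x) = x"
  defines "A \<equiv> flood_alg p B D enc dec H"
begin

lemma pick_news_range:
  assumes "v \<in> pverts (Gs (sample p (Suc k)))"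
  shows "pick (news k v) \<in> insert None (Some ` ({1..n} \<times> {..<D}))"
proof (cases "pick (news k v)")
  case (Some x)
  obtain w j where x: "x = (w, j)"
    by (cases x)
  have "w \<in> pverts (Gs (sample p (k - j)))" "j \<le> D - 2"
    using news_sound[OF _ assms, of w j] pick_SomeD[OF Some] x by auto
  then have "w \<in> {1..n}" "j < D"
    using pverts_antimono[of 0 "sample p (k - j)"] pverts_0 D_ge by auto
  then show ?thesis
    using Some x by simp
qed simp

lemma nbrs_at_eq:
  assumes "\<And>i. i < t \<Longrightarrow> fst (h ! i) = neighbors (Gs (Suc i)) v" "i \<le> t"
  shows "nbrs_at (Gs 0) h v i = neighbors (Gs i) v"
  using assms by (cases i) (auto simp: nbrs_at_def)

text \<open>Agreement on a prefix only, so that it also covers histories extended by the provisional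
  entry \<open>(N, Map.empty)\<close> used when sending.\<close>

definition records :: "observation list \<Rightarrow> nat \<Rightarrow> nat \<Rightarrow> bool" where
  "records h t v \<longleftrightarrow> (\<forall>i < t. h ! i = history A Gs t v ! i)"

lemma records_fst: "records h t v \<Longrightarrow> i < t \<Longrightarrow> fst (h ! i) = neighbors (Gs (Suc i)) v"
  by (simp add: records_def nth_history)

lemma records_mono: "records h t v \<Longrightarrow> s \<le> t \<Longrightarrow> records h s v"
  by (simp add: records_def nth_history)

lemma records_snd: "records h t v \<Longrightarrow> i < t \<Longrightarrow> u \<in> neighbors (Gs (Suc i)) v \<Longrightarrow>
    snd (h ! i) u = Some (send A u (Gs 0) (history A Gs i u) (neighbors (Gs (Suc i)) u) v)"
  by (simp add: records_def nth_history)

text \<open>The inductive step of \<open>local_news_eq\<close>, isolated for reuse: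
  \<open>local\<close> is the induction hypothesis for the sender. The pieces are computed from
  histories of different lengths, but all from the same message.\<close>

lemma received_eq_if:
  assumes local: "\<And>h. records h (k * p) u \<Longrightarrow> fst (h ! (k * p)) = neighbors (Gs (Suc (k * p))) u \<Longrightarrow>
      local_news dec p D (Gs 0) h u k = news k u"
    and h: "records h (k * p + p) v" and u: "u \<in> neighbors (Gs (k * p + p)) v"
  shows "received dec p h k u = pick (news k u)"
proof -
  have chunk: "the (snd (h ! (k * p + q)) u) = take B (drop (q * B) (enc (pick (news k u))))"
    if "q < p" for q
  proof -
    let ?t = "k * p + q"
    let ?h = "history A Gs ?t u @ [(neighbors (Gs (Suc ?t)) u, Map.empty)]"
    \<comment> \<open>Neighbor lists only shrink, so a neighbor at the end of the phase was one
      throughout and every piece arrived.\<close>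
    have "u \<in> neighbors (Gs (Suc ?t)) v"
      using u neighbors_antimono[of "Suc ?t" "k * p + p" v] that by auto
    then have "the (snd (h ! ?t) u) =
        send A u (Gs 0) (history A Gs ?t u) (neighbors (Gs (Suc ?t)) u) v"
      using records_snd[OF h, of ?t u] that by simp
    also have "\<dots> = take B (drop (q * B) (enc (pick (local_news dec p D (Gs 0) ?h u k))))"
      using that p_pos by (simp add: A_def flood_alg_def)
    also have "local_news dec p D (Gs 0) ?h u k = news k u"
    \<comment> \<open>For \<open>q = 0\<close> the entry at position \<open>k * p\<close> is the
      appended provisional one; for \<open>q > 0\<close> it already belongs to the history.\<close>
    proof (rule local)
      show "records ?h (k * p) u"
        by (simp add: records_def nth_append nth_history)
      show "fst (?h ! (k * p)) = neighbors (Gs (Suc (k * p))) u"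
        by (cases "q = 0") (simp_all add: nth_append nth_history)
    qed
    finally show ?thesis .
  qed
  have "concat (map (\<lambda>i. the (snd (h ! i) u)) [k * p..<k * p + p]) =
      concat (map (\<lambda>q. take B (drop (q * B) (enc (pick (news k u))))) [0..<p])"
  proof -
    have "map (\<lambda>i. the (snd (h ! i) u)) [k * p..<k * p + p] =
        map (\<lambda>q. the (snd (h ! (k * p + q)) u)) [0..<p]"
      by (rule nth_equalityI) auto
    also have "\<dots> = map (\<lambda>q. take B (drop (q * B) (enc (pick (news k u))))) [0..<p]"
      by (rule map_cong) (auto simp: chunk)
    finally show ?thesis
      by simp
  qed
  also have "\<dots> = enc (pick (news k u))"
    using length_enc by (simp add: concat_chunks)
  finally have "received dec p h k u = dec (enc (pick (news k u)))"
    by (simp add: received_def)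
  moreover have "sample p (Suc k) \<le> k * p + p"
    using p_pos by simp
  then have "u \<in> pverts (Gs (sample p (Suc k)))"
    using u neighbors_eq[of u "k * p + p" v] pverts_antimono by blast
  ultimately show ?thesis
    using dec_enc[OF pick_news_range] by simp
qed

lemma local_news_eq:
  "records h (k * p) v \<Longrightarrow> fst (h ! (k * p)) = neighbors (Gs (Suc (k * p))) v \<Longrightarrow>
     local_news dec p D (Gs 0) h v k = news k v"
proof (induction k arbitrary: h v)
  case 0
  then show ?case
    by (auto simp: local_news_def nbrs_at_def)
next
  case (Suc k)
  have hd: "fst (h ! i) = neighbors (Gs (Suc i)) v" if "i < Suc (Suc k * p)" for i
    using that Suc.prems records_fst[OF Suc.prems(1), of i] by (cases "i = Suc k * p") auto
  have nbrs: "i \<le> Suc (Suc k * p) \<Longrightarrow> nbrs_at (Gs 0) h v i = neighbors (Gs i) v" for i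
    using nbrs_at_eq[OF hd] .
  have "sample p (Suc k) \<le> Suc (Suc k * p)" "sample p (Suc (Suc k)) \<le> Suc (Suc k * p)"
    "Suc k * p \<le> Suc (Suc k * p)"
    by simp_all
  note nbrs3 = this[THEN nbrs]
  have "records h (k * p + p) v"
    using Suc.prems(1) by (simp add: add.commute)
  then have rec: "received dec p h k u = pick (news k u)" if "u \<in> neighbors (Gs (Suc k * p)) v" for u
    using received_eq_if[OF Suc.IH] that by (simp add: add.commute)
  show ?case
    unfolding local_news_def news.simps nbrs3 using rec by auto
qed

lemma received_eq:
  "records h (k * p + p) v \<Longrightarrow> u \<in> neighbors (Gs (k * p + p)) v \<Longrightarrow>
     received dec p h k u = pick (news k u)"
  by (rule received_eq_if[OF local_news_eq])

lemma local_heard_eq: "local_heard dec p (Gs 0) (history A Gs t v) v = heard t v"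
proof -
  have rec: "records (history A Gs t v) t v"
    by (simp add: records_def)
  have nbrs: "nbrs_at (Gs 0) (history A Gs t v) v i = neighbors (Gs i) v" if "i \<le> t" for i
    using nbrs_at_eq[OF records_fst[OF rec] that] .
  have "received dec p (history A Gs t v) k u = pick (news k u)"
    if "k * p + p \<le> t" "u \<in> neighbors (Gs (k * p + p)) v" for k u
    using received_eq[OF records_mono[OF rec that(1)] that(2)] .
  then show ?thesis
    using nbrs by (fastforce simp: local_heard_def heard_def)
qed

lemma out_flood_alg:
  assumes H: "pair_graph H" "Digraph_Component.connected (with_proj H)" "diam H \<le> D"
    and r: "r \<ge> 1" and quiet: "quiet_after r Gs i" and v: "v \<in> pverts (Gs i)"
  shows "out A v (Gs 0) (history A Gs (i + r - 1) v) = mem_list H (Gs i) v"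
proof -
  let ?t = "i + r - 1"
  have Gt: "Gs ?t = Gs i"
    using quiet_after_eq[OF quiet, of ?t] r by simp
  have "pverts S \<inter> heard ?t v = {} \<longleftrightarrow> pverts S \<subseteq> pverts (Gs i)" if S: "S \<in> mem_list H (Gs 0) v" for S
  proof
    assume "pverts S \<subseteq> pverts (Gs i)"
    then show "pverts S \<inter> heard ?t v = {}"
      using heard_sound[of _ ?t v] v Gt by auto
  next
    assume disj: "pverts S \<inter> heard ?t v = {}"
    have sub: "subgraph (with_proj S) (with_proj (Gs 0))" and vS: "v \<in> pverts S"
      and iso: "digraph_iso (with_proj H) (with_proj S)"
      using S by (auto simp: mem_list_def)
    then have "pair_wf_digraph S"
      by (simp add: subgraph_def wf_digraph_wp_iff)
    then have wf: "parcs S \<subseteq> pverts S \<times> pverts S"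
      by (auto simp: pair_wf_digraph_def)
    have walks: "\<exists>d \<le> D. (x, y) \<in> parcs S ^^ d" if "x \<in> pverts S" "y \<in> pverts S" for x y
      using relpow_le_diam_iso[OF H(1,2) iso that] H(3) by (meson le_trans)
    have "parcs S \<subseteq> parcs (Gs 0)" "pverts S \<subseteq> pverts (Gs 0)"
      using sub by (auto simp: subgraph_def)
    then show "pverts S \<subseteq> pverts (Gs i)"
      using heard_complete[OF _ wf _ walks quiet r refl vS] v disj Gt by auto
  qed
  then show ?thesis
    unfolding mem_list_eq[of H i] local_heard_eq[symmetric] by (auto simp: A_def flood_alg_def)
qed

end

end

lemma flood_alg_correct:
  assumes H: "pair_graph H" "Digraph_Component.connected (with_proj H)" "diam H \<le> D"
    and D: "D \<ge> 2" and p: "p \<ge> 1" and budget: "D * p \<le> Suc r"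
    and enc: "\<And>x. length (enc x) = p * B"
    and dec: "\<And>x. x \<in> insert None (Some ` ({1..n} \<times> {..<D})) \<Longrightarrow> dec (enc x) = x"
  shows "r_round_MemList r H n (flood_alg p B D enc dec H)"
  unfolding r_round_MemList_def
proof (intro allI impI ballI)
  fix Gs i v
  assume Gs: "node_deletion_sequence n Gs \<and> r_round_promise r Gs"
    and *: "quiet_after r Gs i" "v \<in> pverts (Gs i)"
  interpret flooding n Gs r p D
    using Gs D p budget by unfold_locales auto
  have "2 * 1 \<le> D * p"
    using D p by (rule mult_le_mono)
  then have "r \<ge> 1"
    using budget by simp
  then show "out (flood_alg p B D enc dec H) v (Gs 0)
      (history (flood_alg p B D enc dec H) Gs (i + r - 1) v) = mem_list H (Gs i) v"
    using out_flood_alg[OF enc dec H] * by blast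
qed

text \<open>The piece number \<open>m mod p\<close> is below \<open>p\<close>, so no piece runs over
  the end of the message.\<close>

lemma bandwidth_flood_alg:
  assumes "p \<ge> 1" "\<And>x. length (enc x) = p * B"
  shows "has_bandwidth (flood_alg p B D enc dec H) B"
proof -
  have "q * B + B \<le> p * B" if "q < p" for q
  proof -
    have "Suc q * B \<le> p * B"
      using that by (intro mult_le_mono1) simp
    then show ?thesis
      by simp
  qed
  then have "B \<le> p * B - (m mod p) * B" for m
    using assms(1) by (metis add_le_imp_le_diff add.commute less_le_trans mod_less_divisor zero_less_one)
  then show ?thesis
    by (simp add: has_bandwidth_def flood_alg_def assms(2) min_absorb2)
qed

section \<open>Bandwidth\<close>

lemma bandwidth_complexity_le:
  "has_bandwidth A B \<Longrightarrow> r_round_MemList r H n A \<Longrightarrow> bandwidth_complexity r H n \<le> enat B"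
  unfolding bandwidth_complexity_def by (rule INF_lower) blast

text \<open>There are \<open>n * D\<close> pairs of a node and a tag, and silence is one more
  message; by counting, all of them have distinct codes of \<open>p * B\<close> bits.\<close>

lemma bandwidth_complexity_le_if_codes:
  assumes H: "pair_graph H" "Digraph_Component.connected (with_proj H)" "diam H \<le> D"
    and D: "D \<ge> 2" and p: "p \<ge> 1" and budget: "D * p \<le> Suc r"
    and codes: "Suc (n * D) \<le> 2 ^ (p * B)"
  shows "bandwidth_complexity r H n \<le> enat B"
proof -
  let ?M = "insert None (Some ` ({1..n} \<times> {..<D}))"
  let ?L = "{xs :: bool list. length xs = p * B}"
  have L: "finite ?L" "card ?L = 2 ^ (p * B)"
    using finite_lists_length_eq[of "UNIV :: bool set"] card_lists_length_eq[of "UNIV :: bool set"]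
    by auto
  have "card ?M = Suc (n * D)"
    by (subst card_insert_disjoint) (auto simp: card_image card_cartesian_product)
  then have "\<exists>f. f ` ?M \<subseteq> ?L \<and> inj_on f ?M"
    using codes L by (intro card_le_inj) auto
  then obtain f where f: "f ` ?M \<subseteq> ?L" "inj_on f ?M"
    by blast
  \<comment> \<open>The default has the right length because \<open>has_bandwidth\<close> ranges
    over all histories, including those that no execution produces.\<close>
  define enc where "enc x = (if x \<in> ?M then f x else replicate (p * B) False)" for x
  define dec where "dec = the_inv_into ?M f"
  have len: "length (enc x) = p * B" for x
    using f(1) by (auto simp: enc_def)
  have "dec (enc x) = x" if "x \<in> ?M" for x
    unfolding dec_def enc_def if_P[OF that] by (rule the_inv_into_f_f[OF f(2) that])
  then have "r_round_MemList r H n (flood_alg p B D enc dec H)"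
    by (rule flood_alg_correct[OF H D p budget len])
  then show ?thesis
    using bandwidth_flood_alg[OF p len] by (rule bandwidth_complexity_le[rotated])
qed

text \<open>For one node the logarithm vanishes and no bit is available to encode a flood, but there
  is also no copy with three vertices to list.\<close>

lemma bandwidth_complexity_single_node:
  assumes "card (pverts H) \<ge> 3"
  shows "bandwidth_complexity r H 1 \<le> enat 0"
proof (rule bandwidth_complexity_le)
  let ?A = "\<lparr>send = \<lambda>_ _ _ _ _. [], out = \<lambda>_ _ _. {}\<rparr>"
  show "has_bandwidth ?A 0"
    by (simp add: has_bandwidth_def)
  have "mem_list H (Gs i) v = {}" if "node_deletion_sequence 1 Gs" for Gs i v
  proof -
    interpret deletions 1 Gs
      using that by unfold_locales
    have "pverts (Gs i) \<subseteq> {1}"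
      using pverts_antimono[of 0 i] pverts_0 by simp
    then have small: "card (pverts S) \<le> 1" if "pverts S \<subseteq> pverts (Gs i)" for S
      using card_mono[of "{1}" "pverts S"] that by auto
    have large: "card (pverts S) \<ge> 3" "pverts S \<subseteq> pverts (Gs i)" if "S \<in> mem_list H (Gs i) v" for S
      using that assms card_pverts_digraph_iso[of H S] by (simp_all add: mem_list_def subgraph_def)
    have "S \<notin> mem_list H (Gs i) v" for S
    proof
      assume "S \<in> mem_list H (Gs i) v"
      then have "card (pverts S) \<ge> 3" "card (pverts S) \<le> 1"
        using small large by blast+
      then show False
        by simp
    qed
    then show ?thesis
      by blast
  qed
  then show "r_round_MemList r H 1 ?A"
    by (simp add: r_round_MemList_def)
qed

text \<open>The phase length is at least \<open>r / (2 * D)\<close>, so a message has at least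
  \<open>(D + 2) * log 2 n\<close> bits, enough for \<open>n ^ (D + 2)\<close> codes. The bound
  \<open>D < n ^ D\<close> shows that this covers all messages.\<close>

lemma codes_suffice:
  assumes n: "n \<ge> 2" and D: "D \<ge> 1" and r: "D \<le> Suc r" "r \<ge> 1"
    and B: "B = nat \<lceil>real (2 * D * (D + 2)) * log 2 (real n) / real r\<rceil>"
  shows "Suc (n * D) \<le> 2 ^ ((Suc r div D) * B)"
proof -
  let ?p = "Suc r div D"
  have lg: "log 2 n > 0"
    using n by simp
  have p: "?p \<ge> 1"
    using r(1) D by (simp add: div_greater_zero_iff Suc_leI)
  have "r < D * ?p + D"
    using D by (metis Suc_lessD dividend_less_times_div less_le_trans mult.commute mult_Suc_right
        add.commute zero_less_one)
  \<comment> \<open>Rounding down costs at most a factor 2, since the quotient is at least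
    1.\<close>
  also have "\<dots> \<le> 2 * D * ?p"
    using p by simp
  finally have "real r \<le> real (2 * D * ?p)"
    by (intro of_nat_mono less_imp_le)
  then have "real r * (real (D + 2) * log 2 n) \<le> real (2 * D * ?p) * (real (D + 2) * log 2 n)"
    using lg by (intro mult_right_mono) auto
  then have "real (D + 2) * log 2 n \<le> ?p * (real (2 * D * (D + 2)) * log 2 n / r)"
    using r(2) by (simp add: field_simps)
  also have "\<dots> \<le> ?p * real B"
    unfolding B by (intro mult_left_mono) (rule of_nat_ceiling, simp)
  finally have le: "real (D + 2) * log 2 n \<le> real (?p * B)"
    by simp
  have "real (n ^ (D + 2)) = (2 powr log 2 n) powr real (D + 2)"
  proof -
    have "2 powr log 2 (real n) = real n" "real n > 0"
      using n by simp_all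
    then show ?thesis
      by (simp only: powr_realpow of_nat_power)
  qed
  also have "\<dots> = 2 powr (real (D + 2) * log 2 n)"
    unfolding powr_powr by (simp only: mult.commute)
  also have "\<dots> \<le> 2 powr real (?p * B)"
    using le by simp
  also have "\<dots> = real (2 ^ (?p * B))"
    by (simp add: powr_realpow del: of_nat_mult)
  finally have "n ^ (D + 2) \<le> 2 ^ (?p * B)"
    by (simp only: of_nat_le_iff)
  moreover have "Suc (n * D) \<le> n ^ (D + 2)"
  proof -
    have "D < n ^ D"
      using n power_gt_expt by simp
    then have "Suc (n * D) \<le> n * n ^ D"
      using n by (metis Suc_leI mult_less_mono2 pos2 less_le_trans)
    also have "\<dots> \<le> n ^ (D + 2)"
      using n by simp
    finally show ?thesis .
  qed
  ultimately show ?thesis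
    by linarith
qed

theorem theorem5p11:
  fixes H :: "'a pair_pre_digraph"
  assumes "pair_graph H"
    and "Digraph_Component.connected (with_proj H)"
    and "card (pverts H) \<ge> 3"
  shows "\<exists>C::real. C > 0 \<and>
    (\<forall>r n :: nat. r \<ge> 1 \<longrightarrow> r \<ge> diam H - 1 \<longrightarrow> n \<ge> 1 \<longrightarrow>
       bandwidth_complexity r H n \<le> enat (nat \<lceil>C * log 2 (real n) / real r\<rceil>))"
proof -
  \<comment> \<open>Taking at least 2 also covers diameter 1, and \<open>D \<le> r + 1\<close> still
    holds because \<open>r \<ge> 1\<close>.\<close>
  define D where "D = max 2 (diam H)"
  have D: "D \<ge> 2" "diam H \<le> D"
    by (simp_all add: D_def)
  show ?thesis
  proof (intro exI[of _ "real (2 * D * (D + 2))"] conjI allI impI)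
    show "0 < real (2 * D * (D + 2))"
      using D(1) by (simp del: of_nat_mult of_nat_add)
    fix r n :: nat
    assume r: "r \<ge> 1" "r \<ge> diam H - 1" and n: "n \<ge> 1"
    define B where "B = nat \<lceil>real (2 * D * (D + 2)) * log 2 (real n) / real r\<rceil>"
    have Dr: "D \<le> Suc r"
      using r by (simp add: D_def)
    have "bandwidth_complexity r H n \<le> enat B"
    proof (cases "n = 1")
      case True
      then show ?thesis
        using bandwidth_complexity_single_node[OF assms(3), of r] by (simp add: B_def)
    next
      case False
      show ?thesis
      proof (rule bandwidth_complexity_le_if_codes[OF assms(1,2) D(2,1)])
        show "Suc r div D \<ge> 1"
          using Dr D(1) by (simp add: div_greater_zero_iff Suc_leI)
        show "D * (Suc r div D) \<le> Suc r"
          by simp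
        show "Suc (n * D) \<le> 2 ^ (Suc r div D * B)"
          using codes_suffice[OF _ _ Dr r(1) B_def] False n D(1) by simp
      qed
    qed
    then show "bandwidth_complexity r H n \<le>
        enat (nat \<lceil>real (2 * D * (D + 2)) * log 2 (real n) / real r\<rceil>)"
      by (simp add: B_def)
  qed
qed

end
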